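(* Let $A$ and $B$ be isoclinic skew left braces. Then the groups $\Lambda_{A^{\mathrm{op}}}$ and $\Lambda_{B^{\mathrm{op}}}$ are isoclinic if any of the following conditions is satisfied: (1) $\mathrm{Z}(\Lambda_{A^{\mathrm{op}}}) = \mathrm{Ann}(A)\times \mathrm{Ann}(A)$ and $\mathrm{Z}(\Lambda_{B^{\mathrm{op}}}) = \mathrm{Ann}(B)\times \mathrm{Ann}(B)$; (2) $\mathrm{Ann}(A)\cap A'=\{1\}$ and $\mathrm{Ann}(B)\cap B'=\{1\}$.
   Context: A skew left brace is a triple $(A,\cdot,\circ)$ where $(A,\cdot)$ and $(A,\circ)$ are groups with $a\circ(b\cdot c)=(a\circ b)\cdot a^{-1}\cdot(a\circ c)$ for all $a,b,c\in A$, where $a^{-1}$ is the inverse in $(A,\cdot)$. We write $ab=a\cdot b$; the two groups share the identity $1$. The map $\lambda:(A,\circ)\to\mathrm{Aut}(A,\cdot)$, $\lambda_a(b)=a^{-1}(a\circ b)$, is a group homomorphism, and so is $\lambda^{\mathrm{op}}:(A,\circ)\to\mathrm{Aut}(A,\cdot)$, $\lambda^{\mathrm{op}}_a(b)=(a\circ b)a^{-1}=a\lambda_a(b)a^{-1}$. The group $\Lambda_{A^{\mathrm{op}}}=(A,\cdot)\rtimes_{\lambda^{\mathrm{op}}}(A,\circ)$ is the set $A\times A$ with product $(a_1,b_1)(a_2,b_2)=(a_1\lambda^{\mathrm{op}}_{b_1}(a_2),\,b_1\circ b_2)$. $\mathrm{Z}(G)$ denotes the center of a group $G$ and $G'$ its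 commutator subgroup. An ideal of $A$ is a subset $I$ that is a normal subgroup of both $(A,\cdot)$ and $(A,\circ)$ with $\lambda_a(I)\subseteq I$ for all $a\in A$; then $A/I$ is a skew left brace. The annihilator is $\mathrm{Ann}(A)=\mathrm{Ker}(\lambda)\cap \mathrm{Z}(A,\cdot)\cap \mathrm{Z}(A,\circ)$; it is an ideal. The commutator $A'$ of the skew left brace $A$ is the subgroup of $(A,\cdot)$ generated by all elements $aba^{-1}b^{-1}$ and $a\lambda_b(a^{-1})$ with $a,b\in A$; it is an ideal, hence itself a skew left brace. Two skew left braces $A,B$ are isoclinic if there are skew left brace isomorphisms $\xi_1:A/\mathrm{Ann}(A)\to B/\mathrm{Ann}(B)$ and $\xi_2:A'\to B'$ such that $\xi_2\circ\theta_A=\theta_B\circ(\xi_1\times\xi_1)$ and $\xi_2\circ\theta_A^*=\theta_B^*\circ(\xi_1\times\xi_1)$, where $\theta_A,\theta_A^*:(A/\mathrm{Ann}(A))\times (A/\mathrm{Ann}(A))\to A'$ are the well-defined maps $\theta_A(\overline a,\overline b)=aba^{-1}b^{-1}$ and $\theta_A^*(\overline a,\overline b)=\lambda_a(b)b^{-1}$, and $\theta_B,\theta_B^*$ are defined similarly. Two groups $G,H$ are isoclinic if there are group isomorphisms $\xi_1:G/\mathrm{Z}(G)\to H/\mathrm{Z}(H)$ and $\xi_2:G'\to H'$ with $\xi_2\circ\eta_G=\eta_H\circ(\xi_1\times\xi_1)$, where $\eta_G(\overline{g_1},\overline{g_2})=g_1g_2g_1^{-1}g_2^{-1}$ and $\eta_H$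 is defined similarly. *)

theory Defs
  imports "HOL-Algebra.Generated_Groups"
begin

section \<open>Skew left braces\<close>

text \<open>
  The inherited monoid structure of a brace is the group \<open>(A, \<cdot>)\<close>, so that HOL-Algebra
  notions apply to the record directly. The group \<open>(A, \<circ>)\<close> is written with
  \<open>\<diamondop>\<close>; it shares the unit of \<open>(A, \<cdot>)\<close>, which is no restriction, since the brace identity
  forces the two units to agree.
\<close>

record 'a skew_brace = "'a monoid" +
  circ :: "'a \<Rightarrow> 'a \<Rightarrow> 'a" (infixl \<open>\<diamondop>\<index>\<close> 70)

definition circ_group :: "('a, 'm) skew_brace_scheme \<Rightarrow> 'a monoid" where
  "circ_group A = \<lparr>carrier = carrier A, mult = circ A, one = one A\<rparr>"

locale skew_left_brace = group A for A :: "('a, 'm) skew_brace_scheme" (structure) +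
  assumes circ_is_group: "group (circ_group A)"
    and brace_identity:
      "\<lbrakk>a \<in> carrier A; b \<in> carrier A; c \<in> carrier A\<rbrakk>
        \<Longrightarrow> a \<diamondop> (b \<otimes> c) = (a \<diamondop> b) \<otimes> inv a \<otimes> (a \<diamondop> c)"

definition brace_lambda :: "('a, 'm) skew_brace_scheme \<Rightarrow> 'a \<Rightarrow> 'a \<Rightarrow> 'a" where
  "brace_lambda A a b = inv\<^bsub>A\<^esub> a \<otimes>\<^bsub>A\<^esub> (a \<diamondop>\<^bsub>A\<^esub> b)"

definition brace_lambda_op :: "('a, 'm) skew_brace_scheme \<Rightarrow> 'a \<Rightarrow> 'a \<Rightarrow> 'a" where
  "brace_lambda_op A a b = (a \<diamondop>\<^bsub>A\<^esub> b) \<otimes>\<^bsub>A\<^esub> inv\<^bsub>A\<^esub> a"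

definition group_center :: "('a, 'm) monoid_scheme \<Rightarrow> 'a set" where
  "group_center G = {z \<in> carrier G. \<forall>g \<in> carrier G. z \<otimes>\<^bsub>G\<^esub> g = g \<otimes>\<^bsub>G\<^esub> z}"

definition lambda_kernel :: "('a, 'm) skew_brace_scheme \<Rightarrow> 'a set" where
  "lambda_kernel A = {a \<in> carrier A. \<forall>b \<in> carrier A. brace_lambda A a b = b}"

definition brace_Ann :: "('a, 'm) skew_brace_scheme \<Rightarrow> 'a set" where
  "brace_Ann A = lambda_kernel A \<inter> group_center A \<inter> group_center (circ_group A)"

definition brace_commutator :: "('a, 'm) skew_brace_scheme \<Rightarrow> 'a set" where
  "brace_commutator A = generate A
     ({a \<otimes>\<^bsub>A\<^esub> b \<otimes>\<^bsub>A\<^esub> inv\<^bsub>A\<^esub> a \<otimes>\<^bsub>A\<^esub> inv\<^bsub>A\<^esub> b | a b. a \<in> carrier A \<and> b \<in> carrier A}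
      \<union> {a \<otimes>\<^bsub>A\<^esub> brace_lambda A b (inv\<^bsub>A\<^esub> a) | a b. a \<in> carrier A \<and> b \<in> carrier A})"

text \<open>
  For an ideal \<open>I\<close> the cosets of \<open>I\<close> in \<open>(A, \<cdot>)\<close> and in \<open>(A, \<circ>)\<close> are the same sets, so
  that both operations of \<open>A/I\<close> are products of subsets of \<open>A\<close>.
\<close>

definition brace_quotient :: "('a, 'm) skew_brace_scheme \<Rightarrow> 'a set \<Rightarrow> 'a set skew_brace" where
  "brace_quotient A I =
     \<lparr>carrier = rcosets\<^bsub>A\<^esub> I, mult = set_mult A, one = I, circ = set_mult (circ_group A)\<rparr>"

definition brace_iso ::
  "('a, 'm) skew_brace_scheme \<Rightarrow> ('b, 'n) skew_brace_scheme \<Rightarrow> ('a \<Rightarrow> 'b) set" where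
  "brace_iso A B = iso A B \<inter> iso (circ_group A) (circ_group B)"


section \<open>Isoclinism\<close>

text \<open>
  A map on cosets given on representatives is the unique value attained on them; the lemmas
  \<open>theta_coset\<close>, \<open>theta_star_coset\<close> and \<open>eta_coset\<close> below show that this value exists.
\<close>

definition theta :: "('a, 'm) skew_brace_scheme \<Rightarrow> 'a set \<Rightarrow> 'a set \<Rightarrow> 'a" where
  "theta A X Y = (THE c. \<exists>a \<in> X. \<exists>b \<in> Y. c = a \<otimes>\<^bsub>A\<^esub> b \<otimes>\<^bsub>A\<^esub> inv\<^bsub>A\<^esub> a \<otimes>\<^bsub>A\<^esub> inv\<^bsub>A\<^esub> b)"

definition theta_star :: "('a, 'm) skew_brace_scheme \<Rightarrow> 'a set \<Rightarrow> 'a set \<Rightarrow> 'a" where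
  "theta_star A X Y = (THE c. \<exists>a \<in> X. \<exists>b \<in> Y. c = brace_lambda A a b \<otimes>\<^bsub>A\<^esub> inv\<^bsub>A\<^esub> b)"

definition eta :: "('a, 'm) monoid_scheme \<Rightarrow> 'a set \<Rightarrow> 'a set \<Rightarrow> 'a" where
  "eta G X Y = (THE c. \<exists>a \<in> X. \<exists>b \<in> Y. c = a \<otimes>\<^bsub>G\<^esub> b \<otimes>\<^bsub>G\<^esub> inv\<^bsub>G\<^esub> a \<otimes>\<^bsub>G\<^esub> inv\<^bsub>G\<^esub> b)"

definition isoclinic_braces ::
  "('a, 'm) skew_brace_scheme \<Rightarrow> ('b, 'n) skew_brace_scheme \<Rightarrow> bool" where
  "isoclinic_braces A B \<longleftrightarrow>
     (\<exists>\<xi>1 \<xi>2.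
        \<xi>1 \<in> brace_iso (brace_quotient A (brace_Ann A)) (brace_quotient B (brace_Ann B)) \<and>
        \<xi>2 \<in> brace_iso (A\<lparr>carrier := brace_commutator A\<rparr>) (B\<lparr>carrier := brace_commutator B\<rparr>) \<and>
        (\<forall>X \<in> carrier (brace_quotient A (brace_Ann A)).
         \<forall>Y \<in> carrier (brace_quotient A (brace_Ann A)).
           \<xi>2 (theta A X Y) = theta B (\<xi>1 X) (\<xi>1 Y) \<and>
           \<xi>2 (theta_star A X Y) = theta_star B (\<xi>1 X) (\<xi>1 Y)))"

definition isoclinic_groups ::
  "('a, 'm) monoid_scheme \<Rightarrow> ('b, 'n) monoid_scheme \<Rightarrow> bool" where
  "isoclinic_groups G H \<longleftrightarrow>
     (\<exists>\<xi>1 \<xi>2.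
        \<xi>1 \<in> iso (G Mod group_center G) (H Mod group_center H) \<and>
        \<xi>2 \<in> iso (G\<lparr>carrier := derived G (carrier G)\<rparr>) (H\<lparr>carrier := derived H (carrier H)\<rparr>) \<and>
        (\<forall>X \<in> carrier (G Mod group_center G).
         \<forall>Y \<in> carrier (G Mod group_center G).
           \<xi>2 (eta G X Y) = eta H (\<xi>1 X) (\<xi>1 Y)))"


section \<open>The group of the opposite brace\<close>

definition semidirect_product ::
  "('a, 'm) monoid_scheme \<Rightarrow> ('b, 'n) monoid_scheme \<Rightarrow> ('b \<Rightarrow> 'a \<Rightarrow> 'a) \<Rightarrow> ('a \<times> 'b) monoid" where
  "semidirect_product G H \<phi> =
     \<lparr>carrier = carrier G \<times> carrier H,
      mult = (\<lambda>(a1, b1) (a2, b2). (a1 \<otimes>\<^bsub>G\<^esub> \<phi> b1 a2, b1 \<otimes>\<^bsub>H\<^esub> b2)),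
      one = (\<one>\<^bsub>G\<^esub>, \<one>\<^bsub>H\<^esub>)\<rparr>"

definition Lambda_op :: "('a, 'm) skew_brace_scheme \<Rightarrow> ('a \<times> 'a) monoid" where
  "Lambda_op A = semidirect_product A (circ_group A) (brace_lambda_op A)"


section \<open>Well-definedness\<close>

lemma circ_group_simps [simp]:
  "carrier (circ_group A) = carrier A"
  "x \<otimes>\<^bsub>circ_group A\<^esub> y = x \<diamondop>\<^bsub>A\<^esub> y"
  "\<one>\<^bsub>circ_group A\<^esub> = \<one>\<^bsub>A\<^esub>"
  by (simp_all add: circ_group_def)

lemma (in group) commutator_central:
  assumes z: "z \<in> group_center G" and w: "w \<in> group_center G"
    and a: "a \<in> carrier G" and b: "b \<in> carrier G"
  shows "(z \<otimes> a) \<otimes> (w \<otimes> b) \<otimes> inv (z \<otimes> a) \<otimes> inv (w \<otimes> b) = a \<otimes> b \<otimes> inv a \<otimes> inv b"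
proof -
  have zc: "z \<in> carrier G" and zz: "\<And>g. g \<in> carrier G \<Longrightarrow> z \<otimes> g = g \<otimes> z"
    and wc: "w \<in> carrier G" and ww: "\<And>g. g \<in> carrier G \<Longrightarrow> w \<otimes> g = g \<otimes> w"
    using z w by (auto simp: group_center_def)
  have 1: "(z \<otimes> a) \<otimes> (w \<otimes> b) = (a \<otimes> b) \<otimes> (w \<otimes> z)"
    using zz[of "a \<otimes> (w \<otimes> b)"] ww[of b] zc wc a b by (simp add: m_assoc)
  have 2: "inv (z \<otimes> a) \<otimes> inv (w \<otimes> b) = inv (w \<otimes> z) \<otimes> (inv a \<otimes> inv b)"
  proof -
    have "inv (z \<otimes> a) \<otimes> inv (w \<otimes> b) = inv ((w \<otimes> b) \<otimes> (z \<otimes> a))"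
      using zc wc a b by (simp add: inv_mult_group)
    also have "(w \<otimes> b) \<otimes> (z \<otimes> a) = (b \<otimes> a) \<otimes> (w \<otimes> z)"
      using zz[of a] ww[of "b \<otimes> (a \<otimes> z)"] zz[of w] zc wc a b by (simp add: m_assoc)
    also have "inv \<dots> = inv (w \<otimes> z) \<otimes> (inv a \<otimes> inv b)"
      using zc wc a b by (simp add: inv_mult_group)
    finally show ?thesis .
  qed
  have "(z \<otimes> a) \<otimes> (w \<otimes> b) \<otimes> inv (z \<otimes> a) \<otimes> inv (w \<otimes> b)
      = ((z \<otimes> a) \<otimes> (w \<otimes> b)) \<otimes> (inv (z \<otimes> a) \<otimes> inv (w \<otimes> b))"
    using zc wc a b by (simp add: m_assoc)
  also have "\<dots> = (a \<otimes> b) \<otimes> ((w \<otimes> z) \<otimes> inv (w \<otimes> z)) \<otimes> (inv a \<otimes> inv b)"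
    unfolding 1 2 using m_closed[OF wc zc] a b
    by (intro trans[OF m_assoc[symmetric]] arg_cong2[of _ _ _ _ "mult G"] m_assoc refl) auto
  also have "(w \<otimes> z) \<otimes> inv (w \<otimes> z) = \<one>"
    using zc wc by simp
  finally show ?thesis
    using a b by (simp add: m_assoc)
qed

lemma (in group) eta_coset:
  assumes "a \<in> carrier G" "b \<in> carrier G"
  shows "eta G (group_center G #> a) (group_center G #> b) = a \<otimes> b \<otimes> inv a \<otimes> inv b"
proof -
  have one: "\<one> \<in> group_center G" by (simp add: group_center_def)
  show ?thesis unfolding eta_def
  proof (rule the_equality)
    have "a \<in> group_center G #> a" "b \<in> group_center G #> b"
      using one assms unfolding r_coset_def by force+
    then show "\<exists>a' \<in> group_center G #> a. \<exists>b' \<in> group_center G #> b.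
        a \<otimes> b \<otimes> inv a \<otimes> inv b = a' \<otimes> b' \<otimes> inv a' \<otimes> inv b'" by blast
  qed (use commutator_central assms in \<open>auto simp: r_coset_def\<close>)
qed

context skew_left_brace
begin

interpretation C: group "circ_group A" by (rule circ_is_group)

lemma circ_closed [simp, intro]: "\<lbrakk>a \<in> carrier A; b \<in> carrier A\<rbrakk> \<Longrightarrow> a \<diamondop> b \<in> carrier A"
  using C.m_closed by simp

lemma circ_assoc:
  "\<lbrakk>a \<in> carrier A; b \<in> carrier A; c \<in> carrier A\<rbrakk> \<Longrightarrow> (a \<diamondop> b) \<diamondop> c = a \<diamondop> (b \<diamondop> c)"
  using C.m_assoc by simp

lemma circ_one [simp]: "a \<in> carrier A \<Longrightarrow> \<one> \<diamondop> a = a" "a \<in> carrier A \<Longrightarrow> a \<diamondop> \<one> = a"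
  using C.l_one C.r_one by simp_all

lemma lambda_closed [simp, intro]:
  "\<lbrakk>a \<in> carrier A; b \<in> carrier A\<rbrakk> \<Longrightarrow> brace_lambda A a b \<in> carrier A"
  by (simp add: brace_lambda_def)

lemma circ_eq: "\<lbrakk>a \<in> carrier A; b \<in> carrier A\<rbrakk> \<Longrightarrow> a \<diamondop> b = a \<otimes> brace_lambda A a b"
  by (simp add: brace_lambda_def flip: m_assoc)

lemma lambda_mult:
  assumes "a \<in> carrier A" "b \<in> carrier A" "c \<in> carrier A"
  shows "brace_lambda A a (b \<otimes> c) = brace_lambda A a b \<otimes> brace_lambda A a c"
  using assms by (simp add: brace_lambda_def brace_identity m_assoc)

lemma lambda_circ:
  assumes "a \<in> carrier A" "b \<in> carrier A" "c \<in> carrier A"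
  shows "brace_lambda A (a \<diamondop> b) c = brace_lambda A a (brace_lambda A b c)"
proof -
  have "a \<otimes> brace_lambda A a b \<otimes> brace_lambda A a (brace_lambda A b c) = a \<diamondop> (b \<diamondop> c)"
    using assms by (simp add: circ_eq lambda_mult m_assoc)
  also have "\<dots> = (a \<diamondop> b) \<otimes> brace_lambda A (a \<diamondop> b) c"
    using assms by (simp add: circ_eq[of "a \<diamondop> b" c] flip: circ_assoc)
  also have "\<dots> = a \<otimes> brace_lambda A a b \<otimes> brace_lambda A (a \<diamondop> b) c"
    using assms by (simp add: circ_eq)
  finally show ?thesis using assms by simp
qed

lemma one_in_Ann: "\<one> \<in> brace_Ann A"
  by (simp add: brace_Ann_def lambda_kernel_def group_center_def brace_lambda_def)

lemma AnnD:
  assumes z: "z \<in> brace_Ann A"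
  shows "z \<in> carrier A" "z \<in> group_center A"
    and "\<And>b. b \<in> carrier A \<Longrightarrow> z \<diamondop> b = z \<otimes> b"
    and "\<And>b. b \<in> carrier A \<Longrightarrow> brace_lambda A z b = b"
    and "\<And>b. b \<in> carrier A \<Longrightarrow> brace_lambda A b z = z"
proof -
  show zc: "z \<in> carrier A" and "z \<in> group_center A"
    using z by (auto simp: brace_Ann_def lambda_kernel_def)
  show l: "brace_lambda A z b = b" if "b \<in> carrier A" for b
    using z that by (auto simp: brace_Ann_def lambda_kernel_def)
  show eq: "z \<diamondop> b = z \<otimes> b" if "b \<in> carrier A" for b
    using that zc by (simp add: circ_eq l)
  show "brace_lambda A b z = z" if b: "b \<in> carrier A" for b
  proof -
    have "b \<diamondop> z = z \<diamondop> b" using z b by (auto simp: brace_Ann_def group_center_def)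
    also have "\<dots> = b \<otimes> z" using z b by (auto simp: eq brace_Ann_def group_center_def)
    finally show ?thesis using b zc by (simp add: brace_lambda_def flip: m_assoc)
  qed
qed

lemma coset_Ann_eq: "a \<in> carrier A \<Longrightarrow> brace_Ann A #>\<^bsub>circ_group A\<^esub> a = brace_Ann A #> a"
  using AnnD(3) by (auto simp: r_coset_def)

lemma theta_coset:
  assumes "a \<in> carrier A" "b \<in> carrier A"
  shows "theta A (brace_Ann A #> a) (brace_Ann A #> b) = a \<otimes> b \<otimes> inv a \<otimes> inv b"
  unfolding theta_def
proof (rule the_equality)
  have "a \<in> brace_Ann A #> a" "b \<in> brace_Ann A #> b"
    using one_in_Ann assms unfolding r_coset_def by force+
  then show "\<exists>a' \<in> brace_Ann A #> a. \<exists>b' \<in> brace_Ann A #> b.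
      a \<otimes> b \<otimes> inv a \<otimes> inv b = a' \<otimes> b' \<otimes> inv a' \<otimes> inv b'" by blast
qed (use commutator_central AnnD(2) assms in \<open>auto simp: r_coset_def\<close>)

lemma lambda_central:
  assumes z: "z \<in> brace_Ann A" and w: "w \<in> brace_Ann A"
    and a: "a \<in> carrier A" and b: "b \<in> carrier A"
  shows "brace_lambda A (z \<otimes> a) (w \<otimes> b) \<otimes> inv (w \<otimes> b) = brace_lambda A a b \<otimes> inv b"
proof -
  have wc: "w \<in> carrier A" and ww: "\<And>g. g \<in> carrier A \<Longrightarrow> w \<otimes> g = g \<otimes> w"
    using AnnD(2)[OF w] by (auto simp: group_center_def)
  have "brace_lambda A (z \<otimes> a) (w \<otimes> b) = brace_lambda A a (w \<otimes> b)"
    using AnnD(1,4)[OF z] a b wc by (simp add: lambda_circ flip: AnnD(3)[OF z a])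
  also have "\<dots> = brace_lambda A a b \<otimes> w"
    using AnnD(5)[OF w a] a b wc ww[of "brace_lambda A a b"] by (simp add: lambda_mult)
  finally have *: "brace_lambda A (z \<otimes> a) (w \<otimes> b) = brace_lambda A a b \<otimes> w" .
  have "inv (w \<otimes> b) = inv w \<otimes> inv b"
    using ww[OF b] wc b by (simp add: inv_mult_group)
  then have "w \<otimes> inv (w \<otimes> b) = inv b"
    using wc b by (simp flip: m_assoc)
  then show ?thesis
    unfolding * using a b wc by (simp add: m_assoc)
qed

lemma theta_star_coset:
  assumes "a \<in> carrier A" "b \<in> carrier A"
  shows "theta_star A (brace_Ann A #> a) (brace_Ann A #> b) = brace_lambda A a b \<otimes> inv b"
  unfolding theta_star_def
proof (rule the_equality)
  have "a \<in> brace_Ann A #> a" "b \<in> brace_Ann A #> b"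
    using one_in_Ann assms unfolding r_coset_def by force+
  then show "\<exists>a' \<in> brace_Ann A #> a. \<exists>b' \<in> brace_Ann A #> b.
      brace_lambda A a b \<otimes> inv b = brace_lambda A a' b' \<otimes> inv b'" by blast
qed (use lambda_central assms in \<open>auto simp: r_coset_def\<close>)

lemma lambda_op_eq:
  "\<lbrakk>a \<in> carrier A; b \<in> carrier A\<rbrakk> \<Longrightarrow> brace_lambda_op A a b = a \<otimes> brace_lambda A a b \<otimes> inv a"
  by (simp add: brace_lambda_op_def circ_eq)

lemma lambda_op_closed [simp, intro]:
  "\<lbrakk>a \<in> carrier A; b \<in> carrier A\<rbrakk> \<Longrightarrow> brace_lambda_op A a b \<in> carrier A"
  by (simp add: brace_lambda_op_def)

lemma lambda_op_mult:
  assumes "a \<in> carrier A" "b \<in> carrier A" "c \<in> carrier A"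
  shows "brace_lambda_op A a (b \<otimes> c) = brace_lambda_op A a b \<otimes> brace_lambda_op A a c"
  using assms by (simp add: brace_lambda_op_def brace_identity m_assoc)

lemma lambda_op_circ:
  assumes "a \<in> carrier A" "b \<in> carrier A" "c \<in> carrier A"
  shows "brace_lambda_op A (a \<diamondop> b) c = brace_lambda_op A a (brace_lambda_op A b c)"
proof -
  have circ': "x \<diamondop> y = brace_lambda_op A x y \<otimes> x" if "x \<in> carrier A" "y \<in> carrier A" for x y
    using that by (simp add: brace_lambda_op_def m_assoc)
  have "brace_lambda_op A a (brace_lambda_op A b c) \<otimes> (a \<diamondop> b) = a \<diamondop> (b \<diamondop> c)"
    using assms by (simp add: circ' lambda_op_mult m_assoc)
  also have "\<dots> = brace_lambda_op A (a \<diamondop> b) c \<otimes> (a \<diamondop> b)"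
    using assms circ'[of "a \<diamondop> b" c] by (simp flip: circ_assoc)
  finally show ?thesis using assms by simp
qed

lemma Lambda_op_group: "group (Lambda_op A)"
proof (rule groupI)
  fix x assume "x \<in> carrier (Lambda_op A)"
  then obtain a b where x: "x = (a, b)" and ab: "a \<in> carrier A" "b \<in> carrier A"
    by (auto simp: Lambda_op_def semidirect_product_def)
  let ?b = "inv\<^bsub>circ_group A\<^esub> b"
  have b: "?b \<in> carrier A" "?b \<diamondop> b = \<one>"
    using ab C.inv_closed C.l_inv by simp_all
  have "brace_lambda_op A ?b (inv a) \<otimes> brace_lambda_op A ?b a = brace_lambda_op A ?b \<one>"
    using ab b by (simp flip: lambda_op_mult)
  also have "\<dots> = \<one>" using b by (simp add: brace_lambda_op_def)
  finally show "\<exists>y\<in>carrier (Lambda_op A). y \<otimes>\<^bsub>Lambda_op A\<^esub> x = \<one>\<^bsub>Lambda_op A\<^esub>"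
    using ab b unfolding x
    by (intro bexI[of _ "(brace_lambda_op A ?b (inv a), ?b)"])
       (auto simp: Lambda_op_def semidirect_product_def)
qed (auto simp: Lambda_op_def semidirect_product_def lambda_op_mult lambda_op_circ
      circ_assoc m_assoc brace_lambda_op_def[of A \<one>])

end

end

theory Submission
  imports Defs
begin

text \<open>
  Let \<open>C\<close> be the fibre product of \<open>A\<close> and \<open>B\<close> over \<open>\<xi>\<^sub>1\<close>, that is, the brace of the pairs
  \<open>(a, b)\<close> for which \<open>\<xi>\<^sub>1\<close> maps the class of \<open>a\<close> to the class of \<open>b\<close>. Compatibility of
  \<open>\<xi>\<^sub>1\<close> and \<open>\<xi>\<^sub>2\<close> says that the generators of \<open>C'\<close> lie on the graph of \<open>\<xi>\<^sub>2\<close>, so that both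
  projections are injective on \<open>C'\<close>. Since the derived subgroup of \<open>\<Lambda>\<^sub>C\<close> is contained in
  \<open>C' \<times> C'\<close>, the induced surjections of \<open>\<Lambda>\<^sub>C\<close> onto \<open>\<Lambda>\<^sub>A\<close> and \<open>\<Lambda>\<^sub>B\<close> are injective on the
  derived subgroup, and a surjection with this property is an isoclinism: \<open>\<pi> k\<close> is central iff
  every \<open>\<pi> [k, x]\<close> is trivial, iff every \<open>[k, x]\<close> is trivial, iff \<open>k\<close> is central.
\<close>

section \<open>Isoclinic quotients of a group\<close>

text \<open>By the first isomorphism theorem both targets are copies of \<open>K Mod N\<close>,
  where \<open>N\<close> is the common kernel. The isomorphism runs from \<open>P\<close> back to
  \<open>K Mod N\<close> and on to \<open>Q\<close>. The equation on images of \<open>K\<close> is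
  what later evaluates it on cosets and commutators.\<close>

lemma iso_of_equal_kernels:
  assumes "group_hom K P \<phi>" "\<phi> ` carrier K = carrier P"
    and "group_hom K Q \<psi>" "\<psi> ` carrier K = carrier Q"
    and ker: "kernel K P \<phi> = kernel K Q \<psi>"
  obtains \<xi> where "\<xi> \<in> iso P Q" "\<And>k. k \<in> carrier K \<Longrightarrow> \<xi> (\<phi> k) = \<psi> k"
proof -
  interpret \<phi>: group_hom K P \<phi> by fact
  interpret \<psi>: group_hom K Q \<psi> by fact
  let ?N = "kernel K P \<phi>"
  let ?f = "\<lambda>X. the_elem (\<phi> ` X)" and ?g = "\<lambda>X. the_elem (\<psi> ` X)"
  let ?h = "inv_into (carrier (K Mod ?N)) ?f"
  have f: "?f \<in> iso (K Mod ?N) P" by (rule \<phi>.FactGroup_iso_set) fact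
  have g: "?g \<in> iso (K Mod ?N) Q" unfolding ker by (rule \<psi>.FactGroup_iso_set) fact
  have "group (K Mod ?N)" by (rule normal.factorgroup_is_group) (rule \<phi>.normal_kernel)
  then have h: "?h \<in> iso P (K Mod ?N)" using f by (rule group.iso_set_sym)
  show thesis
  proof (rule that)
    show "?g \<circ> ?h \<in> iso P Q" using h g by (rule iso_set_trans)
    fix k assume k: "k \<in> carrier K"
    let ?X = "?N #>\<^bsub>K\<^esub> k"
    have X: "?X \<in> carrier (K Mod ?N)" using k by (auto simp: carrier_FactGroup)
    have ne: "?X \<noteq> {}" using \<phi>.G.rcos_self[OF k \<phi>.subgroup_kernel] by blast
    have "\<phi> x = \<phi> k" if "x \<in> ?X" for x
      using that k by (auto simp: kernel_def r_coset_def)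
    then have f_X: "?f ?X = \<phi> k" by (rule the_elem_image_unique[OF ne])
    have "\<psi> x = \<psi> k" if "x \<in> ?X" for x
      using that k unfolding ker by (auto simp: kernel_def r_coset_def)
    then have g_X: "?g ?X = \<psi> k" by (rule the_elem_image_unique[OF ne])
    have "inj_on ?f (carrier (K Mod ?N))" using f by (simp add: iso_def bij_betw_def)
    then have "?h (?f ?X) = ?X" using X by (rule inv_into_f_f)
    then show "(?g \<circ> ?h) (\<phi> k) = \<psi> k" by (simp add: f_X g_X)
  qed
qed

lemma (in group) central_subgroup_normal:
  assumes "subgroup N G" "N \<subseteq> group_center G"
  shows "N \<lhd> G"
proof (rule normalI[OF assms(1)], rule ballI)
  fix x assume "x \<in> carrier G"
  then show "N #> x = x <# N"
    using assms(2) unfolding r_coset_def l_coset_def group_center_def by (intro SUP_cong) auto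
qed

lemma (in group) group_center_normal: "group_center G \<lhd> G"
proof -
  have "subgroup (group_center G) G"
  proof (rule subgroupI)
    show "group_center G \<noteq> {}" by (auto simp: group_center_def intro!: exI[of _ \<one>])
  next
    fix z assume "z \<in> group_center G"
    then have z: "z \<in> carrier G" and zc: "\<And>g. g \<in> carrier G \<Longrightarrow> z \<otimes> g = g \<otimes> z"
      by (auto simp: group_center_def)
    \<comment> \<open>Taking inverses in \<open>z (inv g) = (inv g) z\<close> gives this
      equation.\<close>
    have "inv z \<otimes> g = g \<otimes> inv z" if g: "g \<in> carrier G" for g
      using inv_mult_group[of z "inv g"] inv_mult_group[of "inv g" z] zc[of "inv g"] z g by simp
    then show "inv z \<in> group_center G" using z by (simp add: group_center_def)
  next
    fix z w assume z: "z \<in> group_center G" and w: "w \<in> group_center G"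
    then have c: "z \<in> carrier G" "w \<in> carrier G" by (auto simp: group_center_def)
    have "z \<otimes> w \<otimes> g = g \<otimes> (z \<otimes> w)" if g: "g \<in> carrier G" for g
    proof -
      have "z \<otimes> w \<otimes> g = z \<otimes> g \<otimes> w" using w c g by (simp add: group_center_def m_assoc)
      also have "z \<otimes> g = g \<otimes> z" using z g by (simp add: group_center_def)
      finally show ?thesis using c g by (simp add: m_assoc)
    qed
    then show "z \<otimes> w \<in> group_center G" using c by (simp add: group_center_def)
  qed (auto simp: group_center_def)
  then show ?thesis by (rule central_subgroup_normal) simp
qed

lemma (in group) commutator_eq_one_iff:
  assumes "a \<in> carrier G" "b \<in> carrier G"
  shows "a \<otimes> b \<otimes> inv a \<otimes> inv b = \<one> \<longleftrightarrow> a \<otimes> b = b \<otimes> a"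
proof -
  have "a \<otimes> b \<otimes> inv a \<otimes> inv b = (a \<otimes> b) \<otimes> inv (b \<otimes> a)"
    using assms by (simp add: m_assoc inv_mult_group)
  then show ?thesis using assms inv_equality[of "a \<otimes> b" "inv (b \<otimes> a)"]
    by (metis inv_inv inv_closed m_closed r_inv)
qed

lemma (in group) commutator_in_derived:
  "\<lbrakk>a \<in> carrier G; b \<in> carrier G\<rbrakk> \<Longrightarrow> a \<otimes> b \<otimes> inv a \<otimes> inv b \<in> derived G (carrier G)"
  unfolding derived_def by (rule generate.incl) auto

lemma (in group) coset_eq_subgroup_iff:
  assumes "subgroup N G" "x \<in> carrier G"
  shows "N #> x = N \<longleftrightarrow> x \<in> N"
  using rcos_self[OF assms(2,1)] coset_join2[OF assms(2,1)] by blast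

lemma group_hom_coset_center:
  assumes "group_hom K G \<pi>"
  shows "group_hom K (G Mod group_center G) (\<lambda>k. group_center G #>\<^bsub>G\<^esub> \<pi> k)"
proof -
  interpret group_hom K G \<pi> by fact
  interpret N: normal "group_center G" G by (rule H.group_center_normal)
  have "(\<lambda>k. group_center G #>\<^bsub>G\<^esub> \<pi> k) \<in> hom K (G Mod group_center G)"
    using N.r_coset_hom_Mod by (auto simp: hom_def Pi_iff)
  then show ?thesis
    by (intro group_hom.intro group_hom_axioms.intro N.factorgroup_is_group) auto
qed

lemma kernel_coset_center:
  assumes "group_hom K G \<pi>" and surj: "\<pi> ` carrier K = carrier G"
    and triv: "kernel K G \<pi> \<inter> derived K (carrier K) = {\<one>\<^bsub>K\<^esub>}"
  shows "kernel K (G Mod group_center G) (\<lambda>k. group_center G #>\<^bsub>G\<^esub> \<pi> k) = group_center K"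
proof -
  interpret group_hom K G \<pi> by fact
  have "\<pi> k \<in> group_center G \<longleftrightarrow> k \<in> group_center K" if k: "k \<in> carrier K" for k
  proof -
    let ?c = "\<lambda>x. k \<otimes>\<^bsub>K\<^esub> x \<otimes>\<^bsub>K\<^esub> inv\<^bsub>K\<^esub> k \<otimes>\<^bsub>K\<^esub> inv\<^bsub>K\<^esub> x"
    \<comment> \<open>By surjectivity, centrality in \<open>G\<close> can be tested against images
      of elements of \<open>K\<close>.\<close>
    have "\<pi> k \<in> group_center G \<longleftrightarrow> (\<forall>x \<in> carrier K. \<pi> k \<otimes>\<^bsub>G\<^esub> \<pi> x = \<pi> x \<otimes>\<^bsub>G\<^esub> \<pi> k)"
      using k by (auto simp: group_center_def simp flip: surj)
    also have "\<dots> \<longleftrightarrow> (\<forall>x \<in> carrier K. \<pi> (?c x) = \<one>\<^bsub>G\<^esub>)"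
      using k by (intro ball_cong refl) (simp add: H.commutator_eq_one_iff)
    \<comment> \<open>Commutators lie in the derived subgroup, which meets the kernel
      trivially.\<close>
    also have "\<dots> \<longleftrightarrow> (\<forall>x \<in> carrier K. ?c x = \<one>\<^bsub>K\<^esub>)"
    proof (intro ball_cong refl)
      fix x assume "x \<in> carrier K"
      then have "?c x \<in> carrier K" "?c x \<in> derived K (carrier K)"
        using k G.commutator_in_derived by auto
      then show "\<pi> (?c x) = \<one>\<^bsub>G\<^esub> \<longleftrightarrow> ?c x = \<one>\<^bsub>K\<^esub>"
        using triv hom_one by (auto simp: kernel_def)
    qed
    also have "\<dots> \<longleftrightarrow> k \<in> group_center K"
      using k by (auto simp: group_center_def G.commutator_eq_one_iff)
    finally show ?thesis .
  qed
  moreover have "group_center G #>\<^bsub>G\<^esub> \<pi> k = group_center G \<longleftrightarrow> \<pi> k \<in> group_center G"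
    if "k \<in> carrier K" for k
    using that H.group_center_normal by (intro H.coset_eq_subgroup_iff normal_imp_subgroup) auto
  moreover have "group_center K \<subseteq> carrier K" by (auto simp: group_center_def)
  ultimately show ?thesis by (auto simp: kernel_def)
qed

lemma group_hom_restrict_derived:
  assumes "group_hom K G \<pi>" and surj: "\<pi> ` carrier K = carrier G"
  shows "group_hom (K\<lparr>carrier := derived K (carrier K)\<rparr>) (G\<lparr>carrier := derived G (carrier G)\<rparr>) \<pi>"
    and "\<pi> ` derived K (carrier K) = derived G (carrier G)"
proof -
  interpret group_hom K G \<pi> by fact
  show im: "\<pi> ` derived K (carrier K) = derived G (carrier G)"
    using derived_img[of "carrier K"] surj by simp
  have sub: "derived K (carrier K) \<subseteq> carrier K" by (rule G.derived_in_carrier) simp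
  then have "\<pi> \<in> hom (K\<lparr>carrier := derived K (carrier K)\<rparr>) (G\<lparr>carrier := derived G (carrier G)\<rparr>)"
    by (auto simp: hom_def subset_iff simp flip: im)
  then show "group_hom (K\<lparr>carrier := derived K (carrier K)\<rparr>) (G\<lparr>carrier := derived G (carrier G)\<rparr>) \<pi>"
    by (intro group_hom.intro group_hom_axioms.intro G.subgroup_imp_group H.subgroup_imp_group
        G.derived_is_subgroup H.derived_is_subgroup) auto
qed

text \<open>The maps from \<open>K\<close> onto the two central quotients both have kernel Z(K), and
  the maps from K' onto the two derived subgroups both have trivial kernel. Hence
  \<open>iso_of_equal_kernels\<close> yields \<open>\<xi>1\<close> and \<open>\<xi>2\<close>, and
  each matches the images of one element of \<open>K\<close>. They are compatible because, after
  lifting to \<open>K\<close>, both values of \<open>eta\<close> are images of the same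
  commutator.\<close>

lemma isoclinic_groups_of_common_cover:
  assumes \<pi>: "group_hom K G \<pi>" "\<pi> ` carrier K = carrier G"
    and \<rho>: "group_hom K H \<rho>" "\<rho> ` carrier K = carrier H"
    and k\<pi>: "kernel K G \<pi> \<inter> derived K (carrier K) = {\<one>\<^bsub>K\<^esub>}"
    and k\<rho>: "kernel K H \<rho> \<inter> derived K (carrier K) = {\<one>\<^bsub>K\<^esub>}"
  shows "isoclinic_groups G H"
proof -
  interpret \<pi>: group_hom K G \<pi> by fact
  interpret \<rho>: group_hom K H \<rho> by fact
  let ?ZG = "group_center G" and ?ZH = "group_center H"
  let ?K' = "K\<lparr>carrier := derived K (carrier K)\<rparr>"
  let ?G' = "G\<lparr>carrier := derived G (carrier G)\<rparr>"
  let ?H' = "H\<lparr>carrier := derived H (carrier H)\<rparr>"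
  have "(\<lambda>k. ?ZG #>\<^bsub>G\<^esub> \<pi> k) ` carrier K = carrier (G Mod ?ZG)"
    "(\<lambda>k. ?ZH #>\<^bsub>H\<^esub> \<rho> k) ` carrier K = carrier (H Mod ?ZH)"
    by (simp_all add: carrier_FactGroup image_image flip: \<pi>(2) \<rho>(2))
  then obtain \<xi>1 where \<xi>1: "\<xi>1 \<in> iso (G Mod ?ZG) (H Mod ?ZH)"
    and \<xi>1_eq: "\<And>k. k \<in> carrier K \<Longrightarrow> \<xi>1 (?ZG #>\<^bsub>G\<^esub> \<pi> k) = ?ZH #>\<^bsub>H\<^esub> \<rho> k"
    using iso_of_equal_kernels[OF group_hom_coset_center[OF \<pi>(1)] _ group_hom_coset_center[OF \<rho>(1)]]
      kernel_coset_center[OF \<pi> k\<pi>] kernel_coset_center[OF \<rho> k\<rho>] by metis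
  have sub: "derived K (carrier K) \<subseteq> carrier K" by (rule \<pi>.G.derived_in_carrier) simp
  then have "kernel ?K' ?G' \<pi> = kernel ?K' ?H' \<rho>"
    using k\<pi> k\<rho> by (auto simp: kernel_def)
  then obtain \<xi>2 where \<xi>2: "\<xi>2 \<in> iso ?G' ?H'"
    and \<xi>2_eq: "\<And>k. k \<in> derived K (carrier K) \<Longrightarrow> \<xi>2 (\<pi> k) = \<rho> k"
    using iso_of_equal_kernels[OF group_hom_restrict_derived(1)[OF \<pi>] _ group_hom_restrict_derived(1)[OF \<rho>]]
      group_hom_restrict_derived(2)[OF \<pi>] group_hom_restrict_derived(2)[OF \<rho>] by auto
  have "\<xi>2 (eta G X Y) = eta H (\<xi>1 X) (\<xi>1 Y)"
    if X: "X \<in> carrier (G Mod ?ZG)" and Y: "Y \<in> carrier (G Mod ?ZG)" for X Y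
  proof -
    obtain x y where x: "x \<in> carrier K" "X = ?ZG #>\<^bsub>G\<^esub> \<pi> x" and y: "y \<in> carrier K" "Y = ?ZG #>\<^bsub>G\<^esub> \<pi> y"
      using X Y by (auto simp: carrier_FactGroup simp flip: \<pi>(2))
    let ?c = "x \<otimes>\<^bsub>K\<^esub> y \<otimes>\<^bsub>K\<^esub> inv\<^bsub>K\<^esub> x \<otimes>\<^bsub>K\<^esub> inv\<^bsub>K\<^esub> y"
    have "eta G X Y = \<pi> ?c" using x y by (simp add: \<pi>.H.eta_coset)
    moreover have "eta H (\<xi>1 X) (\<xi>1 Y) = \<rho> ?c" using x y by (simp add: \<xi>1_eq \<rho>.H.eta_coset)
    ultimately show ?thesis using \<xi>2_eq[OF \<pi>.G.commutator_in_derived[OF x(1) y(1)]] by simp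
  qed
  then show ?thesis unfolding isoclinic_groups_def using \<xi>1 \<xi>2 by blast
qed

section \<open>The annihilator and the commutator of a brace\<close>

lemma (in group_hom) derived_subset_kernel:
  assumes "comm_group H"
  shows "derived G (carrier G) \<subseteq> kernel G H h"
proof -
  interpret C: comm_group H by fact
  have "h ` carrier G \<subseteq> carrier H" by auto
  then have "h ` derived G (carrier G) = {\<one>\<^bsub>H\<^esub>}"
    using derived_img[of "carrier G"] C.derived_eq_singleton by simp
  then show ?thesis using G.derived_in_carrier[of "carrier G"] by (auto simp: kernel_def)
qed

context skew_left_brace
begin

interpretation C: group "circ_group A" by (rule circ_is_group)

lemma lambda_one [simp]: "b \<in> carrier A \<Longrightarrow> brace_lambda A \<one> b = b"
  by (simp add: brace_lambda_def)

lemma lambda_at_one [simp]: "b \<in> carrier A \<Longrightarrow> brace_lambda A b \<one> = \<one>"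
  by (simp add: brace_lambda_def)

lemma lambda_inv:
  assumes "a \<in> carrier A" "b \<in> carrier A"
  shows "brace_lambda A a (inv b) = inv (brace_lambda A a b)"
  using assms by (intro inv_equality[symmetric]) (simp_all flip: lambda_mult)

text \<open>Centrality in the circle group is replaced by a condition on \<lambda>, which is easier
  to check on products and inverses. For such a \<open>z\<close>, the elements
  \<open>z \<diamondop> b\<close> and \<open>b \<diamondop> z\<close> equal
  \<open>z \<otimes> b\<close> and \<open>b \<otimes> z\<close>.\<close>

lemma AnnI:
  assumes z: "z \<in> group_center A"
    and l: "\<And>b. b \<in> carrier A \<Longrightarrow> brace_lambda A z b = b"
    and r: "\<And>b. b \<in> carrier A \<Longrightarrow> brace_lambda A b z = z"
  shows "z \<in> brace_Ann A"
  using assms by (auto simp: brace_Ann_def lambda_kernel_def group_center_def circ_eq)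

lemma Ann_normal: "brace_Ann A \<lhd> A"
proof -
  interpret Z: normal "group_center A" A by (rule group_center_normal)
  have "subgroup (brace_Ann A) A"
  proof (rule subgroupI)
    show "brace_Ann A \<noteq> {}" using one_in_Ann by blast
  next
    fix z assume z: "z \<in> brace_Ann A"
    note zD = AnnD[OF z]
    show "inv z \<in> brace_Ann A"
    proof (rule AnnI)
      fix b assume b: "b \<in> carrier A"
      \<comment> \<open>Thus \<lambda> at \<open>z\<close> undoes \<lambda> at \<open>inv z\<close>.
        The former is the identity, hence so is the latter.\<close>
      have "z \<diamondop> inv z = \<one>" using zD by simp
      then have "brace_lambda A z (brace_lambda A (inv z) b) = b"
        using zD(1) b by (simp flip: lambda_circ)
      then show "brace_lambda A (inv z) b = b" using zD b by simp
      show "brace_lambda A b (inv z) = inv z" using zD b by (simp add: lambda_inv)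
    qed (use zD in simp)
  next
    fix z w assume z: "z \<in> brace_Ann A" and w: "w \<in> brace_Ann A"
    note zD = AnnD[OF z] and wD = AnnD[OF w]
    show "z \<otimes> w \<in> brace_Ann A"
    proof (rule AnnI)
      fix b assume b: "b \<in> carrier A"
      show "brace_lambda A (z \<otimes> w) b = b"
        using zD(1,4) wD(1,4) b by (simp add: lambda_circ flip: zD(3))
      show "brace_lambda A b (z \<otimes> w) = z \<otimes> w"
        using zD wD b by (simp add: lambda_mult)
    qed (use zD wD in simp)
  qed (use AnnD in auto)
  then show ?thesis using AnnD(2) by (intro central_subgroup_normal) auto
qed

text \<open>Both operations, and therefore both inverses, agree on the annihilator, so it is also a
  subgroup for the circle operation. It is normal there because it is central.\<close>

lemma circ_group_Ann_normal: "brace_Ann A \<lhd> circ_group A"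
proof -
  interpret I: normal "brace_Ann A" A by (rule Ann_normal)
  have "subgroup (brace_Ann A) (circ_group A)"
  proof (rule C.subgroupI)
    show "brace_Ann A \<noteq> {}" using one_in_Ann by blast
  next
    fix z assume z: "z \<in> brace_Ann A"
    have "inv\<^bsub>circ_group A\<^esub> z = inv z"
      using AnnD[of "inv z"] z by (intro C.inv_equality) auto
    then show "inv\<^bsub>circ_group A\<^esub> z \<in> brace_Ann A" using z by simp
  qed (use AnnD in auto)
  then show ?thesis by (rule C.central_subgroup_normal) (simp add: brace_Ann_def)
qed

text \<open>The quotient brace is built on cosets of the multiplicative group. This identification
  turns the circle half of a brace isomorphism into a homomorphism of factor groups.\<close>

lemma circ_group_brace_quotient_Ann:
  "circ_group (brace_quotient A (brace_Ann A)) = circ_group A Mod brace_Ann A"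
  using coset_Ann_eq by (auto simp: circ_group_def brace_quotient_def FactGroup_def RCOSETS_def)

section \<open>The commutator of a brace and the derived subgroup of its semidirect product\<close>

lemma brace_commutator_subset: "brace_commutator A \<subseteq> carrier A"
  unfolding brace_commutator_def by (rule generate_incl) auto

lemma commutator_in_brace_commutator:
  assumes "a \<in> carrier A" "b \<in> carrier A"
  shows "a \<otimes> b \<otimes> inv a \<otimes> inv b \<in> brace_commutator A"
  unfolding brace_commutator_def using assms by (intro generate.incl) blast

lemma subgroup_brace_commutator: "subgroup (brace_commutator A) A"
  unfolding brace_commutator_def by (rule generate_is_subgroup) auto

text \<open>This element, a value of \<open>theta_star\<close>, is the inverse of the generator
  \<open>b \<otimes> brace_lambda A a (inv b)\<close>.\<close>

lemma lambda_diff_in_brace_commutator: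
  assumes "a \<in> carrier A" "b \<in> carrier A"
  shows "brace_lambda A a b \<otimes> inv b \<in> brace_commutator A"
proof -
  have "b \<otimes> brace_lambda A a (inv b) \<in> brace_commutator A"
    unfolding brace_commutator_def using assms by (intro generate.incl) blast
  then have "inv (b \<otimes> brace_lambda A a (inv b)) \<in> brace_commutator A"
    by (rule subgroup.m_inv_closed[OF subgroup_brace_commutator])
  then show ?thesis using assms by (simp add: inv_mult_group lambda_inv)
qed

text \<open>The conjugate of \<open>h\<close> by \<open>x\<close> is [x, h] h, and A' contains every
  multiplicative commutator.\<close>

lemma brace_commutator_normal: "brace_commutator A \<lhd> A"
proof -
  interpret I: subgroup "brace_commutator A" A by (rule subgroup_brace_commutator)
  have "x \<otimes> h \<otimes> inv x \<in> brace_commutator A" if "x \<in> carrier A" "h \<in> brace_commutator A" for x h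
  proof -
    have "(x \<otimes> h \<otimes> inv x \<otimes> inv h) \<otimes> h \<in> brace_commutator A"
      using that commutator_in_brace_commutator I.subset by blast
    then show ?thesis using that by (simp add: m_assoc)
  qed
  then show ?thesis by (simp add: normal_inv_iff subgroup_brace_commutator)
qed

lemma comm_group_Mod_brace_commutator: "comm_group (A Mod brace_commutator A)"
proof -
  interpret I: normal "brace_commutator A" A by (rule brace_commutator_normal)
  have "brace_commutator A #> (a \<otimes> b) = brace_commutator A #> (b \<otimes> a)"
    if "a \<in> carrier A" "b \<in> carrier A" for a b
  proof (rule repr_independence[symmetric])
    have "inv b \<otimes> (b \<otimes> a) = a" using that by (simp flip: m_assoc)
    \<comment> \<open>The witness comes from ab = [a, b] ba.\<close>
    then show "a \<otimes> b \<in> brace_commutator A #> (b \<otimes> a)"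
      using that commutator_in_brace_commutator[OF that]
      by (auto simp: r_coset_def m_assoc intro!: bexI[of _ "a \<otimes> b \<otimes> inv a \<otimes> inv b"])
  qed (use that in \<open>simp_all add: I.is_subgroup\<close>)
  then show ?thesis
    by (intro group.group_comm_groupI I.factorgroup_is_group) (auto simp: carrier_FactGroup I.rcos_sum)
qed

text \<open>
  Modulo \<open>A'\<close> every \<open>\<lambda>\<close>-action is trivial, so both coordinates of \<open>\<Lambda>\<close> map homomorphically to
  the abelian group \<open>A / A'\<close>.
\<close>

lemma derived_Lambda_op:
  "derived (Lambda_op A) (carrier (Lambda_op A)) \<subseteq> brace_commutator A \<times> brace_commutator A"
proof -
  let ?I = "brace_commutator A"
  let ?Q = "A Mod ?I"
  interpret I: normal ?I A by (rule brace_commutator_normal)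
  interpret Q: comm_group ?Q by (rule comm_group_Mod_brace_commutator)
  have \<pi>: "?I #> (a \<otimes> b) = (?I #> a) \<otimes>\<^bsub>?Q\<^esub> (?I #> b)"
    if "a \<in> carrier A" "b \<in> carrier A" for a b
    using that by (simp add: I.rcos_sum)
  have mem: "?I #> a \<in> carrier ?Q" if "a \<in> carrier A" for a
    using that by (simp add: carrier_FactGroup)
  have lam: "?I #> brace_lambda A a b = ?I #> b" if "a \<in> carrier A" "b \<in> carrier A" for a b
  proof (rule repr_independence[symmetric])
    show "brace_lambda A a b \<in> ?I #> b"
      using that lambda_diff_in_brace_commutator[OF that]
      by (auto simp: r_coset_def m_assoc intro!: bexI[of _ "brace_lambda A a b \<otimes> inv b"])
  qed (use that in \<open>simp_all add: I.is_subgroup\<close>)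
  \<comment> \<open>Conjugation by \<open>a\<close>, which separates \<open>brace_lambda_op\<close>
    from \<open>brace_lambda\<close>, disappears in the abelian quotient.\<close>
  have lam_op: "?I #> brace_lambda_op A a b = ?I #> b" if "a \<in> carrier A" "b \<in> carrier A" for a b
  proof -
    have "?I #> brace_lambda_op A a b = (?I #> a) \<otimes>\<^bsub>?Q\<^esub> (?I #> b) \<otimes>\<^bsub>?Q\<^esub> (?I #> inv a)"
      using that by (simp only: lambda_op_eq \<pi> lam lambda_closed inv_closed m_closed)
    also have "\<dots> = (?I #> b) \<otimes>\<^bsub>?Q\<^esub> (?I #> (a \<otimes> inv a))"
      using that Q.m_comm[of "?I #> a" "?I #> b"] Q.m_assoc by (simp only: \<pi> mem inv_closed)
    also have "\<dots> = ?I #> b" using that by (simp flip: \<pi> del: mult_FactGroup)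
    finally show ?thesis .
  qed
  have circ: "?I #> (a \<diamondop> b) = (?I #> a) \<otimes>\<^bsub>?Q\<^esub> (?I #> b)" if "a \<in> carrier A" "b \<in> carrier A" for a b
    using that by (simp only: circ_eq \<pi> lam lambda_closed)
  have "(\<lambda>x. ?I #> fst x) \<in> hom (Lambda_op A) ?Q" "(\<lambda>x. ?I #> snd x) \<in> hom (Lambda_op A) ?Q"
    using \<pi> mem lam_op circ
    by (auto simp: hom_def Lambda_op_def semidirect_product_def simp del: mult_FactGroup)
  then have "group_hom (Lambda_op A) ?Q (\<lambda>x. ?I #> fst x)" "group_hom (Lambda_op A) ?Q (\<lambda>x. ?I #> snd x)"
    by (simp_all add: group_hom_def group_hom_axioms_def Lambda_op_group Q.is_group)
  \<comment> \<open>Both homomorphisms kill the derived subgroup. An element killed by both has its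
    two coordinates in A'.\<close>
  from this[THEN group_hom.derived_subset_kernel, OF Q.comm_group_axioms]
  show ?thesis
    using coset_eq_subgroup_iff[OF subgroup_brace_commutator]
    by (auto simp: kernel_def Lambda_op_def semidirect_product_def subset_iff)
qed

end

section \<open>Fibre products of braces\<close>

definition brace_hom ::
  "('a, 'm) skew_brace_scheme \<Rightarrow> ('b, 'n) skew_brace_scheme \<Rightarrow> ('a \<Rightarrow> 'b) set" where
  "brace_hom A B = hom A B \<inter> hom (circ_group A) (circ_group B)"

text \<open>A map respecting both operations also respects inverses, hence commutes with
  \<open>brace_lambda_op\<close>, which is composed of them.\<close>

lemma group_hom_Lambda_op:
  assumes A: "skew_left_brace A" and B: "skew_left_brace B" and f: "f \<in> brace_hom A B"
  shows "group_hom (Lambda_op A) (Lambda_op B) (map_prod f f)"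
proof -
  interpret A: skew_left_brace A by fact
  interpret B: skew_left_brace B by fact
  interpret f: group_hom A B f
    using f by unfold_locales (simp add: brace_hom_def)
  have circ: "f (a \<diamondop>\<^bsub>A\<^esub> b) = f a \<diamondop>\<^bsub>B\<^esub> f b" if "a \<in> carrier A" "b \<in> carrier A" for a b
    using f that by (auto simp: brace_hom_def hom_def)
  have "map_prod f f \<in> hom (Lambda_op A) (Lambda_op B)"
    by (auto simp: hom_def Lambda_op_def semidirect_product_def brace_lambda_op_def circ)
  then show ?thesis
    by (simp add: group_hom_def group_hom_axioms_def A.Lambda_op_group B.Lambda_op_group)
qed

text \<open>Both coordinates of an element of the derived subgroup lie in A' by
  \<open>derived_Lambda_op\<close>, so \<open>triv\<close> applies to each of them.\<close>

lemma kernel_Lambda_op_derived: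
  assumes A: "skew_left_brace A" and B: "skew_left_brace B" and f: "f \<in> brace_hom A B"
    and triv: "\<And>c. \<lbrakk>c \<in> brace_commutator A; f c = \<one>\<^bsub>B\<^esub>\<rbrakk> \<Longrightarrow> c = \<one>\<^bsub>A\<^esub>"
  shows "kernel (Lambda_op A) (Lambda_op B) (map_prod f f) \<inter>
    derived (Lambda_op A) (carrier (Lambda_op A)) = {\<one>\<^bsub>Lambda_op A\<^esub>}"
proof -
  interpret A: skew_left_brace A by fact
  interpret L: group_hom "Lambda_op A" "Lambda_op B" "map_prod f f"
    using A B f by (rule group_hom_Lambda_op)
  have one: "\<one>\<^bsub>Lambda_op A\<^esub> = (\<one>\<^bsub>A\<^esub>, \<one>\<^bsub>A\<^esub>)" "\<one>\<^bsub>Lambda_op B\<^esub> = (\<one>\<^bsub>B\<^esub>, \<one>\<^bsub>B\<^esub>)"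
    by (simp_all add: Lambda_op_def semidirect_product_def)
  have "x = \<one>\<^bsub>Lambda_op A\<^esub>"
    if "x \<in> derived (Lambda_op A) (carrier (Lambda_op A))" "map_prod f f x = \<one>\<^bsub>Lambda_op B\<^esub>" for x
    using that A.derived_Lambda_op triv by (cases x) (auto simp: one)
  moreover have "\<one>\<^bsub>Lambda_op A\<^esub> \<in> derived (Lambda_op A) (carrier (Lambda_op A))"
    by (rule subgroup.one_closed[OF L.G.derived_is_subgroup]) simp
  ultimately show ?thesis
    using subgroup.one_closed[OF L.subgroup_kernel] unfolding kernel_def by blast
qed

definition fibre_brace ::
  "('a, 'm) skew_brace_scheme \<Rightarrow> ('b, 'n) skew_brace_scheme \<Rightarrow> ('a \<Rightarrow> 'c) \<Rightarrow> ('b \<Rightarrow> 'c)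
    \<Rightarrow> ('a \<times> 'b) skew_brace" where
  "fibre_brace A B \<alpha> \<beta> =
     \<lparr>carrier = {(a, b). a \<in> carrier A \<and> b \<in> carrier B \<and> \<alpha> a = \<beta> b},
      mult = (\<lambda>(a, b) (c, d). (a \<otimes>\<^bsub>A\<^esub> c, b \<otimes>\<^bsub>B\<^esub> d)),
      one = (\<one>\<^bsub>A\<^esub>, \<one>\<^bsub>B\<^esub>),
      circ = (\<lambda>(a, b) (c, d). (a \<diamondop>\<^bsub>A\<^esub> c, b \<diamondop>\<^bsub>B\<^esub> d))\<rparr>"

text \<open>The common target carries two separate group structures, \<open>P\<close> for the
  products and \<open>R\<close> for the circle operations. The fibre product is thus closed under
  both, and the target never has to be shown to be a brace.\<close>

locale fibre_braces =
  A: skew_left_brace A + B: skew_left_brace B +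
  \<alpha>: group_hom A P \<alpha> + \<beta>: group_hom B P \<beta> +
  \<alpha>c: group_hom "circ_group A" R \<alpha> + \<beta>c: group_hom "circ_group B" R \<beta>
  for A :: "('a, 'm) skew_brace_scheme" and B :: "('b, 'n) skew_brace_scheme"
    and P :: "('c, 'p) monoid_scheme" and R :: "('c, 'r) monoid_scheme" and \<alpha> \<beta>
begin

abbreviation C :: "('a \<times> 'b) skew_brace" where "C \<equiv> fibre_brace A B \<alpha> \<beta>"

lemma group_fibre_brace: "group C"
proof (rule groupI)
  fix x assume "x \<in> carrier C"
  then obtain a b where x: "x = (a, b)" "a \<in> carrier A" "b \<in> carrier B" "\<alpha> a = \<beta> b"
    by (auto simp: fibre_brace_def)
  then show "\<exists>y \<in> carrier C. y \<otimes>\<^bsub>C\<^esub> x = \<one>\<^bsub>C\<^esub>"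
    by (intro bexI[of _ "(inv\<^bsub>A\<^esub> a, inv\<^bsub>B\<^esub> b)"]) (auto simp: fibre_brace_def)
qed (auto simp: fibre_brace_def A.m_assoc B.m_assoc)

lemma group_circ_fibre_brace: "group (circ_group C)"
proof (rule groupI)
  fix x assume "x \<in> carrier (circ_group C)"
  then obtain a b where x: "x = (a, b)" "a \<in> carrier A" "b \<in> carrier B" "\<alpha> a = \<beta> b"
    by (auto simp: fibre_brace_def)
  then show "\<exists>y \<in> carrier (circ_group C). y \<otimes>\<^bsub>circ_group C\<^esub> x = \<one>\<^bsub>circ_group C\<^esub>"
    using \<alpha>c.G.inv_closed[of a] \<beta>c.G.inv_closed[of b] \<alpha>c.G.l_inv[of a] \<beta>c.G.l_inv[of b]
      \<alpha>c.hom_inv[of a] \<beta>c.hom_inv[of b]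
    by (intro bexI[of _ "(inv\<^bsub>circ_group A\<^esub> a, inv\<^bsub>circ_group B\<^esub> b)"]) (auto simp: fibre_brace_def)
next
  fix x y assume "x \<in> carrier (circ_group C)" "y \<in> carrier (circ_group C)"
  then show "x \<otimes>\<^bsub>circ_group C\<^esub> y \<in> carrier (circ_group C)"
    using \<alpha>c.hom_mult \<beta>c.hom_mult by (auto simp: fibre_brace_def)
qed (auto simp: fibre_brace_def A.circ_assoc B.circ_assoc)

lemma inv_fibre_brace:
  assumes "(a, b) \<in> carrier C"
  shows "inv\<^bsub>C\<^esub> (a, b) = (inv\<^bsub>A\<^esub> a, inv\<^bsub>B\<^esub> b)"
  using assms by (intro group.inv_equality[OF group_fibre_brace]) (auto simp: fibre_brace_def)

lemma skew_left_brace_fibre_brace: "skew_left_brace C"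
proof (intro skew_left_brace.intro skew_left_brace_axioms.intro group_fibre_brace group_circ_fibre_brace)
  fix x y z assume "x \<in> carrier C" "y \<in> carrier C" "z \<in> carrier C"
  then show "x \<diamondop>\<^bsub>C\<^esub> (y \<otimes>\<^bsub>C\<^esub> z) = (x \<diamondop>\<^bsub>C\<^esub> y) \<otimes>\<^bsub>C\<^esub> inv\<^bsub>C\<^esub> x \<otimes>\<^bsub>C\<^esub> (x \<diamondop>\<^bsub>C\<^esub> z)"
    by (cases x) (auto simp: inv_fibre_brace, auto simp: fibre_brace_def A.brace_identity B.brace_identity)
qed

lemma lambda_fibre_brace:
  assumes "(a, b) \<in> carrier C"
  shows "brace_lambda C (a, b) (c, d) = (brace_lambda A a c, brace_lambda B b d)"
  unfolding brace_lambda_def inv_fibre_brace[OF assms] by (simp add: fibre_brace_def)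

lemma fst_brace_hom: "fst \<in> brace_hom C A" and snd_brace_hom: "snd \<in> brace_hom C B"
  by (auto simp: brace_hom_def hom_def fibre_brace_def)

end

section \<open>Isoclinic braces and their fibre product\<close>

theorem isoclinic_Lambda_op:
  fixes A :: "('a, 'm) skew_brace_scheme" and B :: "('b, 'n) skew_brace_scheme"
  assumes A: "skew_left_brace A" and B: "skew_left_brace B" and AB: "isoclinic_braces A B"
  shows "isoclinic_groups (Lambda_op A) (Lambda_op B)"
proof -
  interpret A: skew_left_brace A by (rule A)
  interpret B: skew_left_brace B by (rule B)
  interpret NA: normal "brace_Ann A" A by (rule A.Ann_normal)
  interpret NB: normal "brace_Ann B" B by (rule B.Ann_normal)
  interpret NAc: normal "brace_Ann A" "circ_group A" by (rule A.circ_group_Ann_normal)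
  interpret NBc: normal "brace_Ann B" "circ_group B" by (rule B.circ_group_Ann_normal)
  let ?A' = "A\<lparr>carrier := brace_commutator A\<rparr>" and ?B' = "B\<lparr>carrier := brace_commutator B\<rparr>"
  let ?QA = "brace_quotient A (brace_Ann A)" and ?QB = "brace_quotient B (brace_Ann B)"
  let ?cA = "\<lambda>a. brace_Ann A #>\<^bsub>A\<^esub> a" and ?cB = "\<lambda>b. brace_Ann B #>\<^bsub>B\<^esub> b"
  obtain \<xi>1 \<xi>2 where \<xi>1: "\<xi>1 \<in> brace_iso ?QA ?QB" and \<xi>2: "\<xi>2 \<in> brace_iso ?A' ?B'"
    and th: "\<And>X Y. \<lbrakk>X \<in> carrier ?QA; Y \<in> carrier ?QA\<rbrakk> \<Longrightarrow> \<xi>2 (theta A X Y) = theta B (\<xi>1 X) (\<xi>1 Y)"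
    and ths: "\<And>X Y. \<lbrakk>X \<in> carrier ?QA; Y \<in> carrier ?QA\<rbrakk> \<Longrightarrow> \<xi>2 (theta_star A X Y) = theta_star B (\<xi>1 X) (\<xi>1 Y)"
    using AB unfolding isoclinic_braces_def by blast
  have cA: "?cA a \<in> carrier ?QA" if "a \<in> carrier A" for a
    using that by (auto simp: brace_quotient_def RCOSETS_def)
  have QB: "Y \<in> carrier ?QB \<longleftrightarrow> (\<exists>b \<in> carrier B. Y = ?cB b)" for Y
    by (auto simp: brace_quotient_def RCOSETS_def)
  have surj: "\<xi>1 ` carrier ?QA = carrier ?QB"
    using \<xi>1 by (auto simp: brace_iso_def iso_def bij_betw_def)
  \<comment> \<open>The fibre product is taken over B/Ann(B), along \<open>?\<alpha>\<close> on one
    side and the projection \<open>?cB\<close> on the other.\<close>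
  let ?\<alpha> = "\<lambda>a. \<xi>1 (?cA a)"
  have "\<xi>1 \<in> hom (A Mod brace_Ann A) (B Mod brace_Ann B)"
    using \<xi>1 by (auto simp: brace_iso_def iso_def hom_def brace_quotient_def FactGroup_def)
  then have \<alpha>: "?\<alpha> \<in> hom A (B Mod brace_Ann B)"
    using NA.r_coset_hom_Mod by (auto simp: hom_def Pi_iff)
  have "\<xi>1 \<in> hom (circ_group A Mod brace_Ann A) (circ_group B Mod brace_Ann B)"
    using \<xi>1 by (simp add: brace_iso_def iso_def A.circ_group_brace_quotient_Ann B.circ_group_brace_quotient_Ann)
  \<comment> \<open>Since the cosets of the annihilator are the same for both operations, the same
    function is a homomorphism for the circle operation.\<close>
  then have \<alpha>c: "?\<alpha> \<in> hom (circ_group A) (circ_group B Mod brace_Ann B)"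
    using NAc.r_coset_hom_Mod A.coset_Ann_eq by (auto simp: hom_def Pi_iff)
  have \<beta>c: "?cB \<in> hom (circ_group B) (circ_group B Mod brace_Ann B)"
    using NBc.r_coset_hom_Mod B.coset_Ann_eq by (auto simp: hom_def Pi_iff)
  interpret fibre_braces A B "B Mod brace_Ann B" "circ_group B Mod brace_Ann B" ?\<alpha> ?cB
    by (intro fibre_braces.intro group_hom.intro group_hom_axioms.intro A B A.is_group B.is_group
        A.circ_is_group B.circ_is_group NB.factorgroup_is_group NBc.factorgroup_is_group
        \<alpha> \<alpha>c \<beta>c NB.r_coset_hom_Mod)
  interpret C: skew_left_brace C by (rule skew_left_brace_fibre_brace)
  interpret \<xi>2: group_hom ?A' ?B' \<xi>2
    using \<xi>2 by (intro group_hom.intro group_hom_axioms.intro A.subgroup_imp_group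
        B.subgroup_imp_group A.subgroup_brace_commutator B.subgroup_brace_commutator)
      (simp add: brace_iso_def iso_def)
  have inj: "inj_on \<xi>2 (brace_commutator A)"
    using \<xi>2 by (simp add: brace_iso_def iso_def bij_betw_def)
  \<comment> \<open>A pair lies in \<open>C\<close> exactly when \<open>\<xi>1\<close> matches the
    classes of its entries, so compatibility with \<open>theta\<close> can be read on
    representatives.\<close>
  have \<xi>2_comm: "\<xi>2 (a \<otimes>\<^bsub>A\<^esub> c \<otimes>\<^bsub>A\<^esub> inv\<^bsub>A\<^esub> a \<otimes>\<^bsub>A\<^esub> inv\<^bsub>A\<^esub> c) = b \<otimes>\<^bsub>B\<^esub> d \<otimes>\<^bsub>B\<^esub> inv\<^bsub>B\<^esub> b \<otimes>\<^bsub>B\<^esub> inv\<^bsub>B\<^esub> d"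
    if "(a, b) \<in> carrier C" "(c, d) \<in> carrier C" for a b c d
    using that th[of "?cA a" "?cA c"] cA by (simp add: fibre_brace_def A.theta_coset B.theta_coset)
  have \<xi>2_lambda: "\<xi>2 (c \<otimes>\<^bsub>A\<^esub> brace_lambda A a (inv\<^bsub>A\<^esub> c)) = d \<otimes>\<^bsub>B\<^esub> brace_lambda B b (inv\<^bsub>B\<^esub> d)"
    if "(a, b) \<in> carrier C" "(c, d) \<in> carrier C" for a b c d
  proof -
    let ?u = "brace_lambda A a c \<otimes>\<^bsub>A\<^esub> inv\<^bsub>A\<^esub> c" and ?v = "brace_lambda B b d \<otimes>\<^bsub>B\<^esub> inv\<^bsub>B\<^esub> d"
    have mem: "a \<in> carrier A" "b \<in> carrier B" "c \<in> carrier A" "d \<in> carrier B"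
      using that by (auto simp: fibre_brace_def)
    have "\<xi>2 ?u = ?v"
      using that ths[of "?cA a" "?cA c"] cA by (simp add: fibre_brace_def A.theta_star_coset B.theta_star_coset)
    moreover have u: "?u \<in> brace_commutator A" and v: "?v \<in> brace_commutator B"
      using mem A.lambda_diff_in_brace_commutator B.lambda_diff_in_brace_commutator by auto
    \<comment> \<open>Compatibility with \<open>theta_star\<close> concerns the inverses of the
      generators. Inversion is transferred through \<open>\<xi>2\<close>, using that inverses in A'
      and B' are those of \<open>A\<close> and \<open>B\<close>.\<close>
    ultimately have "\<xi>2 (inv\<^bsub>A\<^esub> ?u) = inv\<^bsub>B\<^esub> ?v"
      using \<xi>2.hom_inv[of ?u] A.m_inv_consistent[OF A.subgroup_brace_commutator u]
        B.m_inv_consistent[OF B.subgroup_brace_commutator v] by simp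
    then show ?thesis
      using mem by (simp add: A.inv_mult_group B.inv_mult_group A.lambda_inv B.lambda_inv)
  qed
  have gen: "fst x \<in> brace_commutator A \<and> snd x = \<xi>2 (fst x)"
    if "x \<in> {a \<otimes>\<^bsub>C\<^esub> b \<otimes>\<^bsub>C\<^esub> inv\<^bsub>C\<^esub> a \<otimes>\<^bsub>C\<^esub> inv\<^bsub>C\<^esub> b | a b. a \<in> carrier C \<and> b \<in> carrier C}
      \<union> {a \<otimes>\<^bsub>C\<^esub> brace_lambda C b (inv\<^bsub>C\<^esub> a) | a b. a \<in> carrier C \<and> b \<in> carrier C}" for x
    using that
  proof (elim UnE CollectE exE conjE)
    fix p q assume x: "x = p \<otimes>\<^bsub>C\<^esub> q \<otimes>\<^bsub>C\<^esub> inv\<^bsub>C\<^esub> p \<otimes>\<^bsub>C\<^esub> inv\<^bsub>C\<^esub> q" and "p \<in> carrier C" "q \<in> carrier C"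
    then obtain a b c d where ab: "p = (a, b)" "(a, b) \<in> carrier C" and cd: "q = (c, d)" "(c, d) \<in> carrier C"
      by (cases p, cases q) auto
    have "x = (a \<otimes>\<^bsub>A\<^esub> c \<otimes>\<^bsub>A\<^esub> inv\<^bsub>A\<^esub> a \<otimes>\<^bsub>A\<^esub> inv\<^bsub>A\<^esub> c, b \<otimes>\<^bsub>B\<^esub> d \<otimes>\<^bsub>B\<^esub> inv\<^bsub>B\<^esub> b \<otimes>\<^bsub>B\<^esub> inv\<^bsub>B\<^esub> d)"
      unfolding x ab(1) cd(1) inv_fibre_brace[OF ab(2)] inv_fibre_brace[OF cd(2)]
      by (simp add: fibre_brace_def)
    then show ?thesis
      using \<xi>2_comm[OF ab(2) cd(2)] A.commutator_in_brace_commutator[of a c] ab(2) cd(2)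
      by (simp add: fibre_brace_def)
  next
    fix p q assume x: "x = p \<otimes>\<^bsub>C\<^esub> brace_lambda C q (inv\<^bsub>C\<^esub> p)" and "p \<in> carrier C" "q \<in> carrier C"
    then obtain a b c d where ab: "p = (a, b)" "(a, b) \<in> carrier C" and cd: "q = (c, d)" "(c, d) \<in> carrier C"
      by (cases p, cases q) auto
    have "x = (a \<otimes>\<^bsub>A\<^esub> brace_lambda A c (inv\<^bsub>A\<^esub> a), b \<otimes>\<^bsub>B\<^esub> brace_lambda B d (inv\<^bsub>B\<^esub> b))"
      unfolding x ab(1) cd(1) inv_fibre_brace[OF ab(2)] lambda_fibre_brace[OF cd(2)]
      by (simp add: fibre_brace_def)
    moreover have "a \<otimes>\<^bsub>A\<^esub> brace_lambda A c (inv\<^bsub>A\<^esub> a) \<in> brace_commutator A"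
      unfolding brace_commutator_def using ab(2) cd(2)
      by (intro generate.incl UnI2) (auto simp: fibre_brace_def)
    ultimately show ?thesis
      using \<xi>2_lambda[OF cd(2) ab(2)] by simp
  qed
  \<comment> \<open>The graph of the homomorphism \<open>\<xi>2\<close> on A' is closed under
    products and inverses, so it contains C' once it contains the generators. Membership of
    \<open>fst x\<close> in A' is carried along because \<open>\<xi>2\<close> is a homomorphism only
    there.\<close>
  have graph: "fst x \<in> brace_commutator A \<and> snd x = \<xi>2 (fst x)" if "x \<in> brace_commutator C" for x
    using that unfolding brace_commutator_def[of C]
  proof (induction x rule: generate.induct)
    case one
    then show ?case
      using \<xi>2.hom_one \<xi>2.G.one_closed by (simp add: fibre_brace_def)
  next
    case (incl x)
    then show ?case by (rule gen)
  next
    case (inv x)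
    note g = gen[OF inv]
    have "x \<in> carrier C" using inv C.brace_commutator_subset generate.incl
      unfolding brace_commutator_def by blast
    then have "inv\<^bsub>C\<^esub> x = (inv\<^bsub>A\<^esub> (fst x), inv\<^bsub>B\<^esub> (snd x))"
      using inv_fibre_brace[of "fst x" "snd x"] by simp
    moreover have "inv\<^bsub>?A'\<^esub> (fst x) = inv\<^bsub>A\<^esub> (fst x)"
      using g by (intro A.m_inv_consistent A.subgroup_brace_commutator) simp
    moreover have "inv\<^bsub>?B'\<^esub> (snd x) = inv\<^bsub>B\<^esub> (snd x)"
      using g \<xi>2.hom_closed[of "fst x"] by (intro B.m_inv_consistent B.subgroup_brace_commutator) simp
    ultimately show ?case
      using g \<xi>2.hom_inv[of "fst x"] \<xi>2.G.inv_closed[of "fst x"] by simp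
  next
    case (eng x y)
    then show ?case
      using \<xi>2.hom_mult[of "fst x" "fst y"] \<xi>2.G.m_closed[of "fst x" "fst y"]
      by (auto simp: fibre_brace_def split: prod.splits)
  qed
  have fst_surj: "fst ` carrier C = carrier A"
  proof -
    have "\<exists>b \<in> carrier B. ?\<alpha> a = ?cB b" if "a \<in> carrier A" for a
      using cA[OF that] surj QB by blast
    moreover have "fst ` carrier C = {a \<in> carrier A. \<exists>b \<in> carrier B. ?\<alpha> a = ?cB b}"
      by (auto simp: fibre_brace_def image_iff) blast
    ultimately show ?thesis by blast
  qed
  \<comment> \<open>Here surjectivity of \<open>\<xi>1\<close> provides a class of \<open>A\<close>
    over each class of \<open>B\<close>.\<close>
  have snd_surj: "snd ` carrier C = carrier B"
  proof -
    have "\<exists>a \<in> carrier A. ?\<alpha> a = ?cB b" if "b \<in> carrier B" for b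
    proof -
      have "?cB b \<in> \<xi>1 ` carrier ?QA" using that surj QB by blast
      then show ?thesis by (auto simp: brace_quotient_def RCOSETS_def)
    qed
    moreover have "snd ` carrier C = {b \<in> carrier B. \<exists>a \<in> carrier A. ?\<alpha> a = ?cB b}"
      by (auto simp: fibre_brace_def image_iff) blast
    ultimately show ?thesis by blast
  qed
  have one_C: "\<one>\<^bsub>C\<^esub> = (\<one>\<^bsub>A\<^esub>, \<one>\<^bsub>B\<^esub>)" by (simp add: fibre_brace_def)
  show ?thesis
  proof (rule isoclinic_groups_of_common_cover)
    show "group_hom (Lambda_op C) (Lambda_op A) (map_prod fst fst)"
      using C.skew_left_brace_axioms A fst_brace_hom by (rule group_hom_Lambda_op)
    show "group_hom (Lambda_op C) (Lambda_op B) (map_prod snd snd)"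
      using C.skew_left_brace_axioms B snd_brace_hom by (rule group_hom_Lambda_op)
    show "map_prod fst fst ` carrier (Lambda_op C) = carrier (Lambda_op A)"
      "map_prod snd snd ` carrier (Lambda_op C) = carrier (Lambda_op B)"
      by (simp_all add: Lambda_op_def semidirect_product_def fst_surj snd_surj map_prod_surj_on)
    \<comment> \<open>On C' the second entry is \<open>\<xi>2\<close> of the first, so it is trivial
      when the first is.\<close>
    show "kernel (Lambda_op C) (Lambda_op A) (map_prod fst fst) \<inter>
        derived (Lambda_op C) (carrier (Lambda_op C)) = {\<one>\<^bsub>Lambda_op C\<^esub>}"
      using graph \<xi>2.hom_one
      by (intro kernel_Lambda_op_derived C.skew_left_brace_axioms A fst_brace_hom)
        (auto simp: one_C prod_eq_iff)
    \<comment> \<open>For the other projection, injectivity of \<open>\<xi>2\<close> recovers the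
      first entry from the second.\<close>
    have "x = \<one>\<^bsub>A\<^esub>" if "x \<in> brace_commutator A" "\<xi>2 x = \<one>\<^bsub>B\<^esub>" for x
      using inj_onD[OF inj, of x "\<one>\<^bsub>A\<^esub>"] that \<xi>2.hom_one \<xi>2.G.one_closed by simp
    then show "kernel (Lambda_op C) (Lambda_op B) (map_prod snd snd) \<inter>
        derived (Lambda_op C) (carrier (Lambda_op C)) = {\<one>\<^bsub>Lambda_op C\<^esub>}"
      using graph
      by (intro kernel_Lambda_op_derived C.skew_left_brace_axioms B snd_brace_hom)
        (auto simp: one_C prod_eq_iff)
  qed
qed

theorem theorem3p14:
  fixes A :: "'a skew_brace" and B :: "'b skew_brace"
  assumes "skew_left_brace A" and "skew_left_brace B"
    and "isoclinic_braces A B"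
    and "(group_center (Lambda_op A) = brace_Ann A \<times> brace_Ann A \<and>
          group_center (Lambda_op B) = brace_Ann B \<times> brace_Ann B) \<or>
         (brace_Ann A \<inter> brace_commutator A = {\<one>\<^bsub>A\<^esub>} \<and>
          brace_Ann B \<inter> brace_commutator B = {\<one>\<^bsub>B\<^esub>})"
  shows "isoclinic_groups (Lambda_op A) (Lambda_op B)"
  using assms(1-3) by (rule isoclinic_Lambda_op)

end
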